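(* There exist constants $c>0$ and $n_0$ such that for all $n\ge n_0$, $$\mathrm{ex}_3\big(n,\Theta^{B}_{3,217}\big)\ \ge\ c\, n^{4/3},$$ i.e. $\mathrm{ex}_3(n,\Theta^{B}_{3,217})=\Omega(n^{4/3})$.
   Context: For integers $\ell\ge 2$, $t\ge 1$, an $r$-uniform hypergraph $\mathcal{G}$ contains a Berge theta hypergraph $\Theta^{B}_{\ell,t}$ if it has distinct vertices $x,y,v^1_1,\dots,v^1_{\ell-1},\dots,v^t_1,\dots,v^t_{\ell-1}$ and distinct edges $e^1_1,\dots,e^1_\ell,\dots,e^t_1,\dots,e^t_\ell$ such that for every $1\le i\le t$: $\{x,v^i_1\}\subseteq e^i_1$, $\{v^i_{j-1},v^i_j\}\subseteq e^i_j$ for $2\le j\le \ell-1$, and $\{v^i_{\ell-1},y\}\subseteq e^i_\ell$. (Equivalently, there are $t$ internally disjoint Berge paths of length $\ell$ with common endpoints $x,y$, using pairwise distinct edges.) The Turán number $\mathrm{ex}_r(n,\Theta^{B}_{\ell,t})$ is the maximum number of edges in an $r$-uniform hypergraph on $n$ vertices that does not contain $\Theta^{B}_{\ell,t}$. *)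

theory Defs
  imports Complex_Main
begin

definition uniform_hypergraph :: "nat \<Rightarrow> 'a set \<Rightarrow> 'a set set \<Rightarrow> bool" where
  "uniform_hypergraph r V E \<longleftrightarrow> finite V \<and> (\<forall>e\<in>E. e \<subseteq> V \<and> card e = r)"

(* The i-th path has inner vertices v i 1, ..., v i (l - 1) and edges e i 1, ..., e i l.
   The notion is meant for l >= 2 and t >= 1. *)
definition contains_berge_theta :: "nat \<Rightarrow> nat \<Rightarrow> 'a set \<Rightarrow> 'a set set \<Rightarrow> bool" where
  "contains_berge_theta l t V E \<longleftrightarrow>
    (\<exists>x y (v :: nat \<Rightarrow> nat \<Rightarrow> 'a) (e :: nat \<Rightarrow> nat \<Rightarrow> 'a set).
      x \<in> V \<and> y \<in> V \<and> x \<noteq> y \<and>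
      (\<forall>i\<in>{1..t}. \<forall>j\<in>{1..l-1}. v i j \<in> V \<and> v i j \<noteq> x \<and> v i j \<noteq> y) \<and>
      inj_on (\<lambda>(i, j). v i j) ({1..t} \<times> {1..l-1}) \<and>
      (\<forall>i\<in>{1..t}. \<forall>j\<in>{1..l}. e i j \<in> E) \<and>
      inj_on (\<lambda>(i, j). e i j) ({1..t} \<times> {1..l}) \<and>
      (\<forall>i\<in>{1..t}.
        {x, v i 1} \<subseteq> e i 1 \<and>
        (\<forall>j\<in>{2..l-1}. {v i (j - 1), v i j} \<subseteq> e i j) \<and>
        {v i (l - 1), y} \<subseteq> e i l))"

(* The forbidden configuration is given by the predicate "contains" on hypergraphs (V, E).
   Vertices are natural numbers, which is no loss of generality for finite hypergraphs. *)
definition turan_number :: "nat \<Rightarrow> nat \<Rightarrow> (nat set \<Rightarrow> nat set set \<Rightarrow> bool) \<Rightarrow> nat" where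
  "turan_number r n contains =
    Max {card E |V E. uniform_hypergraph r V E \<and> card V = n \<and> \<not> contains V E}"

(* The next two lemmas show that the maximum above is over a finite nonempty set. *)
lemma turan_number_finite:
  "finite {card E |(V :: nat set) E. uniform_hypergraph r V E \<and> card V = n \<and> \<not> contains V E}"
proof (rule finite_subset)
  have "card E \<le> 2 ^ card V" if "uniform_hypergraph r V E" for V :: "nat set" and E
  proof -
    from that have "finite V" "E \<subseteq> Pow V"
      by (auto simp: uniform_hypergraph_def)
    then show ?thesis
      by (metis card_Pow card_mono finite_Pow_iff)
  qed
  then show "{card E |(V :: nat set) E. uniform_hypergraph r V E \<and> card V = n \<and> \<not> contains V E}
      \<subseteq> {..2 ^ n}"
    by blast
  show "finite {..(2::nat) ^ n}"
    by simp
qed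

lemma turan_number_berge_theta_nonempty:
  assumes "l \<ge> 2" and "t \<ge> 1"
  shows "{card E |(V :: nat set) E. uniform_hypergraph r V E \<and> card V = n \<and>
           \<not> contains_berge_theta l t V E} \<noteq> {}"
proof -
  have "uniform_hypergraph r {..<n} {} \<and> card {..<n} = n \<and>
      \<not> contains_berge_theta l t {..<n} {}"
    using assms by (force simp: uniform_hypergraph_def contains_berge_theta_def)
  then show ?thesis
    by blast
qed

end

(*
  Wenger's bipartite graph over the field with q elements has q^3 points, q^3 lines and q^4
  incidences, and contains neither C_4 nor C_6.  Replacing every line by two copies of itself
  turns the incidences into a 3-uniform hypergraph on 3 q^3 vertices.  A Berge path of length 3
  with fixed ends has inner vertices of the type (point, line), (line, point) or (line, line).
  In each case the absence of short cycles leaves no room for two disjoint paths of the same type, so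
  there is no Berge theta with four paths.  Taking q to be a power of two loses
  only a constant factor.
*)
theory Submission
  imports Defs "HOL-Algebra.Algebraic_Closure_Type" "HOL-Library.Z2"
begin

section \<open>Finite fields of order \<open>2 ^ k\<close> inside the algebraic closure of the
  two-element field\<close>

text \<open>The polynomial splits into linear factors, and a repeated factor would make its root a
  root of the derivative too. So the multiset of roots has no repetitions, and its size is the
  degree.\<close>

lemma card_roots_alg_closed:
  fixes p :: "'a :: alg_closed_field poly"
  assumes "p \<noteq> 0" and simple: "\<And>x. poly p x = 0 \<Longrightarrow> poly (pderiv p) x \<noteq> 0"
  shows "card {x. poly p x = 0} = degree p"
proof -
  obtain A where A: "size A = degree p" "p = smult (lead_coeff p) (\<Prod>x\<in>#A. [:-x, 1:])"
    using alg_closed_imp_factorization[OF assms(1)] by blast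
  have roots: "{x. poly p x = 0} = set_mset A"
    by (subst A(2)) (use assms(1) in \<open>auto simp: poly_prod_mset image_iff\<close>)
  have "count A x = 1" if x: "x \<in># A" for x
  proof (rule ccontr)
    assume "count A x \<noteq> 1"
    moreover have "count A x > 0"
      using x by simp
    ultimately have "count A x > 1"
      by linarith
    then have "x \<in># A - {#x#}"
      by (simp add: in_diff_count)
    then obtain B where B: "A = add_mset x (add_mset x B)"
      by (metis insert_DiffM x)
    have "p = [:-x, 1:] * ([:-x, 1:] * smult (lead_coeff p) (\<Prod>x\<in>#B. [:-x, 1:]))"
      by (subst A(2)) (simp add: B)
    then obtain r where "p = [:-x, 1:] * ([:-x, 1:] * r)"
      by blast
    then have "poly (pderiv p) x = 0"
      by (simp add: pderiv_mult del: mult_pCons_left)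
    moreover have "poly p x = 0"
      using roots x by blast
    ultimately show False
      using simple by blast
  qed
  then show ?thesis
    unfolding roots A(1)[symmetric] by (simp add: size_multiset_overloaded_eq)
qed

lemma CHAR_bit: "CHAR(bit) = 2"
proof (rule CHAR_eqI)
  show "of_nat 2 = (0 :: bit)"
    by simp
  show "2 dvd n" if "of_nat n = (0 :: bit)" for n
    using that even_of_nat_iff[of n, where ?'a = bit] by simp
qed

text \<open>The set is the field with $q = 2^k$ elements, realised as the roots of $X^q - X$.\<close>

lemma ex_finite_subring_of_card:
  assumes "k > 0"
  obtains K :: "bit alg_closure set" where "finite K" "card K = 2 ^ k"
    "\<And>x y. x \<in> K \<Longrightarrow> y \<in> K \<Longrightarrow> x - y \<in> K" "\<And>x y. x \<in> K \<Longrightarrow> y \<in> K \<Longrightarrow> x * y \<in> K"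
proof -
  define q :: nat where "q = 2 ^ k"
  define p :: "bit alg_closure poly" where "p = monom 1 q - monom 1 1"
  have q: "q > 1" "of_nat q = (0 :: bit alg_closure)"
    using assms one_less_power[of "2 :: nat" k]
    by (auto simp: q_def of_nat_eq_0_iff_char_dvd CHAR_bit simp del: of_nat_power)
  have deg: "degree p = q"
    using degree_add_eq_left[of "- monom 1 1" "monom (1 :: bit alg_closure) q"] q(1)
    by (simp add: p_def degree_monom_eq)
  have card: "card {x. poly p x = 0} = q"
    unfolding deg[symmetric]
  proof (rule card_roots_alg_closed)
    show "p \<noteq> 0"
      using deg q(1) by auto
    \<comment> \<open>Since q = 0 in characteristic 2, the derivative of X^q - X is the constant
      -1.\<close>
    show "poly (pderiv p) x \<noteq> 0" for x
      by (simp add: p_def pderiv_diff pderiv_monom poly_monom q)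
  qed
  have K: "{x. poly p x = 0} = {x. x ^ q = x}"
    by (simp add: p_def poly_monom)
  \<comment> \<open>Taking q-th powers is an iterated Frobenius map. Applied to \<open>x - y\<close>
    and \<open>y\<close>, its additivity gives closure under subtraction.\<close>
  have add: "(x + y) ^ q = x ^ q + y ^ q" for x y :: "bit alg_closure"
    by (rule freshmans_dream'[of _ k]) (simp_all add: CHAR_bit q_def)
  show ?thesis
  proof
    show "finite {x. poly p x = 0}"
      using card q(1) by (metis card.infinite not_one_less_zero)
    show "card {x. poly p x = 0} = 2 ^ k"
      using card q_def by simp
    show "x - y \<in> {x. poly p x = 0}" if "x \<in> {x. poly p x = 0}" "y \<in> {x. poly p x = 0}" for x y
      using that add[of "x - y" y] unfolding K by (auto simp: eq_diff_eq)
    show "x * y \<in> {x. poly p x = 0}" if "x \<in> {x. poly p x = 0}" "y \<in> {x. poly p x = 0}" for x y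
      using that unfolding K by (simp add: power_mult_distrib)
  qed
qed

section \<open>Wenger's point-line incidence graph and its short cycles\<close>

definition four_cycle_free :: "('a \<times> 'b) set \<Rightarrow> bool" where
  "four_cycle_free I \<longleftrightarrow> (\<forall>p p' l l'.
    (p, l) \<in> I \<longrightarrow> (p', l) \<in> I \<longrightarrow> (p', l') \<in> I \<longrightarrow> (p, l') \<in> I \<longrightarrow> p = p' \<or> l = l')"

definition six_cycle_free :: "('a \<times> 'b) set \<Rightarrow> bool" where
  "six_cycle_free I \<longleftrightarrow> (\<forall>p1 p2 p3 l1 l2 l3.
    (p1, l1) \<in> I \<longrightarrow> (p2, l1) \<in> I \<longrightarrow> (p2, l2) \<in> I \<longrightarrow> (p3, l2) \<in> I \<longrightarrow> (p3, l3) \<in> I \<longrightarrow> (p1, l3) \<in> I \<longrightarrow>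
    p1 = p2 \<or> p2 = p3 \<or> p3 = p1 \<or> l1 = l2 \<or> l2 = l3 \<or> l3 = l1)"

lemma four_cycle_freeD:
  assumes "four_cycle_free I" "(p, l) \<in> I" "(p', l) \<in> I" "(p', l') \<in> I" "(p, l') \<in> I"
  shows "p = p' \<or> l = l'"
  using assms unfolding four_cycle_free_def by blast

lemma six_cycle_freeD:
  assumes "six_cycle_free I" "(p1, l1) \<in> I" "(p2, l1) \<in> I" "(p2, l2) \<in> I" "(p3, l2) \<in> I"
    "(p3, l3) \<in> I" "(p1, l3) \<in> I"
  shows "p1 = p2 \<or> p2 = p3 \<or> p3 = p1 \<or> l1 = l2 \<or> l2 = l3 \<or> l3 = l1"
  using assms unfolding six_cycle_free_def by blast

text \<open>Incidence of (a, b, c) and (u, v, w) means b + v = a u and c + w = a^2 u. A point and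
  the first coordinate of a line through it determine that line, hence the four free
  parameters.\<close>

definition wenger_graph :: "'a :: comm_ring_1 set \<Rightarrow> (('a \<times> 'a \<times> 'a) \<times> ('a \<times> 'a \<times> 'a)) set" where
  "wenger_graph K = (\<lambda>(a, b, c, u). ((a, b, c), (u, a * u - b, a\<^sup>2 * u - c))) ` (K \<times> K \<times> K \<times> K)"

lemma wenger_graphD:
  assumes "((a, b, c), (u, v, w)) \<in> wenger_graph K"
  shows "v = a * u - b" "w = a\<^sup>2 * u - c"
  using assms by (auto simp: wenger_graph_def)

lemma card_wenger_graph: "card (wenger_graph K) = card K ^ 4"
  unfolding wenger_graph_def
  by (subst card_image) (auto simp: inj_on_def card_cartesian_product power4_eq_xxxx)

text \<open>Subtracting the incidence equations of two points eliminates \<open>v\<close> and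
  \<open>w\<close>. Along a closed walk the right-hand sides telescope to 0, leaving relations
  between first coordinates only.\<close>

lemma wenger_graph_common_line:
  assumes "((a, b, c), (u, v, w)) \<in> wenger_graph K" "((a', b', c'), (u, v, w)) \<in> wenger_graph K"
  shows "(a - a') * u = b - b'" "(a\<^sup>2 - a'\<^sup>2) * u = c - c'"
  using assms[THEN wenger_graphD(1)] assms[THEN wenger_graphD(2)] by (auto simp: algebra_simps)

lemma wenger_graph_common_line_eq:
  assumes "((a, b, c), (u, v, w)) \<in> wenger_graph K" "((a', b', c'), (u, v, w)) \<in> wenger_graph K"
    "a = a'"
  shows "(a, b, c) = (a', b', c')"
  using wenger_graph_common_line[OF assms(1,2)] assms(3) by simp

lemma wenger_graph_common_point_eq:
  assumes "((a, b, c), (u, v, w)) \<in> wenger_graph K" "((a, b, c), (u', v', w')) \<in> wenger_graph K"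
    "u = u'"
  shows "(u, v, w) = (u', v', w')"
  using wenger_graphD[OF assms(1)] wenger_graphD[OF assms(2)] assms(3) by simp

lemma four_cycle_free_wenger_graph: "four_cycle_free (wenger_graph (K :: 'a :: idom set))"
  unfolding four_cycle_free_def split_paired_All
proof (intro allI impI)
  fix a b c a' b' c' u v w u' v' w' :: 'a
  assume E: "((a, b, c), u, v, w) \<in> wenger_graph K" "((a', b', c'), u, v, w) \<in> wenger_graph K"
    "((a', b', c'), u', v', w') \<in> wenger_graph K" "((a, b, c), u', v', w') \<in> wenger_graph K"
  \<comment> \<open>Both lines pass through both points, so (a - a') u and (a - a') u' equal b -
    b'.\<close>
  have "(a - a') * (u - u') = 0"
    using wenger_graph_common_line(1)[OF E(1,2)] wenger_graph_common_line(1)[OF E(4,3)]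
    by (simp add: right_diff_distrib)
  then have "a = a' \<or> u = u'"
    by simp
  then show "(a, b, c) = (a', b', c') \<or> (u, v, w) = (u', v', w')"
    using wenger_graph_common_line_eq[OF E(1,2)] wenger_graph_common_point_eq[OF E(1,4)] by blast
qed

lemma six_cycle_free_wenger_graph: "six_cycle_free (wenger_graph (K :: 'a :: idom set))"
  unfolding six_cycle_free_def split_paired_All
proof (intro allI impI)
  fix a1 b1 c1 a2 b2 c2 a3 b3 c3 u1 v1 w1 u2 v2 w2 u3 v3 w3 :: 'a
  assume E: "((a1, b1, c1), u1, v1, w1) \<in> wenger_graph K" "((a2, b2, c2), u1, v1, w1) \<in> wenger_graph K"
    "((a2, b2, c2), u2, v2, w2) \<in> wenger_graph K" "((a3, b3, c3), u2, v2, w2) \<in> wenger_graph K"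
    "((a3, b3, c3), u3, v3, w3) \<in> wenger_graph K" "((a1, b1, c1), u3, v3, w3) \<in> wenger_graph K"
  note lines = wenger_graph_common_line[OF E(1,2)] wenger_graph_common_line[OF E(3,4)]
    wenger_graph_common_line[OF E(5,6)]
  \<comment> \<open>Both bracketed sums vanish by telescoping around the hexagon. The multiplier a1
    + a2 is chosen to cancel u1, and what remains factors.\<close>
  have "(a3 - a1) * (a2 - a3) * (u2 - u3)
      = ((a1\<^sup>2 - a2\<^sup>2) * u1 + (a2\<^sup>2 - a3\<^sup>2) * u2 + (a3\<^sup>2 - a1\<^sup>2) * u3)
        - (a1 + a2) * ((a1 - a2) * u1 + (a2 - a3) * u2 + (a3 - a1) * u3)"
    by (simp add: algebra_simps power2_eq_square)
  also have "\<dots> = 0"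
    unfolding lines by simp
  finally have "a3 = a1 \<or> a2 = a3 \<or> u2 = u3"
    by auto
  then show "(a1, b1, c1) = (a2, b2, c2) \<or> (a2, b2, c2) = (a3, b3, c3) \<or> (a3, b3, c3) = (a1, b1, c1) \<or>
      (u1, v1, w1) = (u2, v2, w2) \<or> (u2, v2, w2) = (u3, v3, w3) \<or> (u3, v3, w3) = (u1, v1, w1)"
    \<comment> \<open>Each vanishing factor compares two neighbours of one vertex of the cycle, so
      equal first coordinates identify those neighbours.\<close>
    using wenger_graph_common_line_eq[OF E(3,4)] wenger_graph_common_line_eq[OF E(5,6)]
      wenger_graph_common_point_eq[OF E(4,5)] by blast
qed

text \<open>This is Wenger's graph with numbers as labels. One numbering serves points and lines
  alike, since the position in the ordered pair keeps the two sides apart.\<close>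

lemma ex_bipartite_girth_eight:
  assumes "k > 0"
  defines "q \<equiv> 2 ^ k :: nat"
  obtains I :: "(nat \<times> nat) set" where "I \<subseteq> {..<q ^ 3} \<times> {..<q ^ 3}" "card I = q ^ 4"
    "four_cycle_free I" "six_cycle_free I"
proof -
  obtain K :: "bit alg_closure set" where K: "finite K" "card K = q"
    "\<And>x y. x \<in> K \<Longrightarrow> y \<in> K \<Longrightarrow> x - y \<in> K" "\<And>x y. x \<in> K \<Longrightarrow> y \<in> K \<Longrightarrow> x * y \<in> K"
    using ex_finite_subring_of_card[OF assms(1)] unfolding q_def by metis
  let ?P = "K \<times> K \<times> K"
  have "card ?P = q ^ 3"
    by (simp add: K card_cartesian_product power3_eq_cube)
  then obtain f where f: "bij_betw f ?P {..<q ^ 3}"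
    using ex_bij_betw_finite_nat[of ?P] K(1) by (auto simp: atLeast0LessThan)
  then have inj: "inj_on f ?P" and fP: "f ` ?P = {..<q ^ 3}"
    by (auto simp: bij_betw_def)
  define W where "W = wenger_graph K"
  have W: "W \<subseteq> ?P \<times> ?P"
    unfolding W_def wenger_graph_def using K by (auto simp: power2_eq_square)
  define I where "I = map_prod f f ` W"
  \<comment> \<open>Membership is expressed through the inverse labelling, so that cycle-freeness
    pulls back from \<open>W\<close> by rewriting.\<close>
  have mem: "(i, j) \<in> I \<longleftrightarrow> i \<in> {..<q ^ 3} \<and> j \<in> {..<q ^ 3} \<and> (inv_into ?P f i, inv_into ?P f j) \<in> W" for i j
  proof
    assume "(i, j) \<in> I"
    then obtain x y where xy: "(x, y) \<in> W" "i = f x" "j = f y"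
      by (auto simp: I_def)
    then have "x \<in> ?P" "y \<in> ?P"
      using W by auto
    then show "i \<in> {..<q ^ 3} \<and> j \<in> {..<q ^ 3} \<and> (inv_into ?P f i, inv_into ?P f j) \<in> W"
      using xy inv_into_f_f[OF inj] fP by (metis imageI)
  next
    assume *: "i \<in> {..<q ^ 3} \<and> j \<in> {..<q ^ 3} \<and> (inv_into ?P f i, inv_into ?P f j) \<in> W"
    then have "f (inv_into ?P f i) = i" "f (inv_into ?P f j) = j"
      unfolding fP[symmetric] by (auto intro: f_inv_into_f)
    then show "(i, j) \<in> I"
      using * unfolding I_def by (metis map_prod_imageI)
  qed
  have inv_eq: "inv_into ?P f i = inv_into ?P f j \<longleftrightarrow> i = j" if "i \<in> {..<q ^ 3}" "j \<in> {..<q ^ 3}" for i j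
    using that unfolding fP[symmetric] by (metis inv_into_injective)
  show ?thesis
  proof
    show "I \<subseteq> {..<q ^ 3} \<times> {..<q ^ 3}"
      using mem by auto
    show "card I = q ^ 4"
      unfolding I_def
      using card_image[OF inj_on_subset[OF map_prod_inj_on[OF inj inj] W]] card_wenger_graph[of K] K(2)
      by (simp add: W_def)
    show "four_cycle_free I"
      using four_cycle_free_wenger_graph[of K] inv_eq
      unfolding W_def[symmetric] four_cycle_free_def mem by meson
    show "six_cycle_free I"
      using six_cycle_free_wenger_graph[of K] inv_eq
      unfolding W_def[symmetric] six_cycle_free_def mem by meson
  qed
qed

section \<open>The 3-uniform hypergraph obtained by doubling the lines\<close>

text \<open>Point p becomes the vertex 3p; the two copies of line l are 3l + 1 and 3l + 2.\<close>

definition blow_up_edge :: "nat \<times> nat \<Rightarrow> nat set" where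
  "blow_up_edge = (\<lambda>(p, l). {3 * p, 3 * l + 1, 3 * l + 2})"

text \<open>The residue mod 3 tells a point (0) from the two copies of a line (1 and 2), and the
  quotient tells which point or line it is.\<close>

lemma mem_blow_up_edge:
  "x \<in> blow_up_edge (p, l) \<longleftrightarrow> x div 3 = (if x mod 3 = 0 then p else l)"
proof -
  have "x = 3 * (x div 3) + x mod 3" "x mod 3 < 3"
    by simp_all
  then obtain d r where x: "x = 3 * d + r" and "r < 3"
    by blast
  then have "r = 0 \<or> r = 1 \<or> r = 2"
    by linarith
  then have "x div 3 = d" "x mod 3 = r"
    using x by auto
  then show ?thesis
    using x \<open>r = 0 \<or> r = 1 \<or> r = 2\<close> unfolding blow_up_edge_def by auto presburger+
qed

lemma card_blow_up_edge: "card (blow_up_edge e) = 3"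
  by (cases e) (simp add: blow_up_edge_def card_insert_if; presburger)

lemma inj_blow_up_edge: "inj blow_up_edge"
proof (rule injI, clarify)
  fix p l p' l'
  assume eq: "blow_up_edge (p, l) = blow_up_edge (p', l')"
  have "3 * p \<in> blow_up_edge (p', l')" "3 * l + 1 \<in> blow_up_edge (p', l')"
    unfolding eq[symmetric] by (auto simp: blow_up_edge_def)
  then show "p = p' \<and> l = l'"
    by (auto simp: mem_blow_up_edge)
qed

section \<open>Berge paths of length three in the blow-up\<close>

text \<open>This is one path of a theta, with its edges named by incidences. Distinct incidences
  give distinct edges because \<open>blow_up_edge\<close> is injective.\<close>

definition berge_path :: "(nat \<times> nat) set \<Rightarrow> nat \<Rightarrow> nat \<Rightarrow> nat \<Rightarrow> nat \<Rightarrow> bool" where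
  "berge_path I x a b y \<longleftrightarrow> distinct [x, a, b, y] \<and>
    (\<exists>f\<in>I. \<exists>g\<in>I. \<exists>h\<in>I. distinct [f, g, h] \<and>
      {x, a} \<subseteq> blow_up_edge f \<and> {a, b} \<subseteq> blow_up_edge g \<and> {b, y} \<subseteq> blow_up_edge h)"

lemma berge_pathE:
  assumes "berge_path I x a b y"
  obtains p1 l1 p2 l2 p3 l3 where "(p1, l1) \<in> I" "(p2, l2) \<in> I" "(p3, l3) \<in> I"
    "p1 = p2 \<Longrightarrow> l1 \<noteq> l2" "p2 = p3 \<Longrightarrow> l2 \<noteq> l3" "p1 = p3 \<Longrightarrow> l1 \<noteq> l3"
    "x \<in> blow_up_edge (p1, l1)" "a \<in> blow_up_edge (p1, l1)" "a \<in> blow_up_edge (p2, l2)"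
    "b \<in> blow_up_edge (p2, l2)" "b \<in> blow_up_edge (p3, l3)" "y \<in> blow_up_edge (p3, l3)"
    "distinct [x, a, b, y]"
proof -
  obtain f g h where "f \<in> I" "g \<in> I" "h \<in> I" "distinct [f, g, h]"
    "{x, a} \<subseteq> blow_up_edge f" "{a, b} \<subseteq> blow_up_edge g" "{b, y} \<subseteq> blow_up_edge h"
    "distinct [x, a, b, y]"
    using assms unfolding berge_path_def by blast
  then show ?thesis
    using that[of "fst f" "snd f" "fst g" "snd g" "fst h" "snd h"] by (simp add: prod_eq_iff)
qed

lemma berge_path_sym:
  assumes "berge_path I x a b y"
  shows "berge_path I y b a x"
proof -
  obtain f g h where "f \<in> I" "g \<in> I" "h \<in> I" "distinct [f, g, h]"
    "{x, a} \<subseteq> blow_up_edge f" "{a, b} \<subseteq> blow_up_edge g" "{b, y} \<subseteq> blow_up_edge h"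
    "distinct [x, a, b, y]"
    using assms unfolding berge_path_def by blast
  then show ?thesis
    unfolding berge_path_def
    by (intro conjI bexI[of _ h] bexI[of _ g] bexI[of _ f]) auto
qed

lemma div_mod_eqI: "x div m = y div m \<Longrightarrow> x mod m = y mod m \<Longrightarrow> x = (y :: nat)"
proof -
  assume *: "x div m = y div m" "x mod m = y mod m"
  have "x = x div m * m + x mod m"
    by simp
  also have "\<dots> = y"
    unfolding * by simp
  finally show ?thesis .
qed

text \<open>Every edge contains exactly one point, so the neighbours of a point on a path are copies
  of lines.\<close>

lemma berge_path_not_both_points:
  assumes "berge_path I x a b y" "a mod 3 = 0"
  shows "b mod 3 \<noteq> 0" "x mod 3 \<noteq> 0"
proof -
  obtain p1 l1 p2 l2 where *: "x \<in> blow_up_edge (p1, l1)" "a \<in> blow_up_edge (p1, l1)"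
    "a \<in> blow_up_edge (p2, l2)" "b \<in> blow_up_edge (p2, l2)" "x \<noteq> a" "a \<noteq> b"
    using assms(1) by (elim berge_pathE) auto
  show "b mod 3 \<noteq> 0"
    using * assms(2) div_mod_eqI[of a 3 b] by (auto simp: mem_blow_up_edge)
  show "x mod 3 \<noteq> 0"
    using * assms(2) div_mod_eqI[of a 3 x] by (auto simp: mem_blow_up_edge)
qed

lemma mod_3_cases_distinct:
  assumes "x mod 3 \<noteq> 0" "a mod 3 \<noteq> 0" "b mod 3 \<noteq> (0 :: nat)" "x mod 3 \<noteq> a mod 3" "x mod 3 \<noteq> b mod 3"
  shows "a mod 3 = b mod 3"
proof -
  have "r mod 3 = 0 \<or> r mod 3 = 1 \<or> r mod 3 = 2" for r :: nat
    by presburger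
  from this[of x] this[of a] this[of b] show ?thesis
    using assms by (elim disjE) simp_all
qed

text \<open>The middle edge has only one line, so \<open>a\<close> and \<open>b\<close> are its two
  copies. The outer edges belong to the same line, whose copies are used up, so the ends must be
  points.\<close>

lemma berge_path_through_line:
  assumes "berge_path I x a b y" "a mod 3 \<noteq> 0" "b mod 3 \<noteq> 0"
  shows "a div 3 = b div 3" "(x div 3, a div 3) \<in> I" "(y div 3, a div 3) \<in> I" "x mod 3 = 0" "y mod 3 = 0"
proof -
  obtain p1 l1 p2 l2 p3 l3 where I: "(p1, l1) \<in> I" "(p3, l3) \<in> I"
    and x: "x \<in> blow_up_edge (p1, l1)" and y: "y \<in> blow_up_edge (p3, l3)"
    and a: "a \<in> blow_up_edge (p1, l1)" "a \<in> blow_up_edge (p2, l2)"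
    and b: "b \<in> blow_up_edge (p2, l2)" "b \<in> blow_up_edge (p3, l3)"
    and dist: "distinct [x, a, b, y]"
    using assms(1) by (rule berge_pathE)
  have l: "l1 = a div 3" "l2 = a div 3" "l2 = b div 3" "l3 = b div 3"
    using a b assms(2,3) by (simp_all add: mem_blow_up_edge)
  show ab: "a div 3 = b div 3"
    using l(3) unfolding l(2) .
  then have ab': "a mod 3 \<noteq> b mod 3"
    using dist div_mod_eqI[of a 3 b] by auto
  show x0: "x mod 3 = 0"
  proof (rule ccontr)
    assume "x mod 3 \<noteq> 0"
    then have "x div 3 = a div 3" "x div 3 = b div 3"
      using x ab unfolding l by (simp_all add: mem_blow_up_edge)
    then show False
      using dist ab' mod_3_cases_distinct[of x a b] assms(2,3) \<open>x mod 3 \<noteq> 0\<close>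
        div_mod_eqI[of x 3 a] div_mod_eqI[of x 3 b] by auto
  qed
  show y0: "y mod 3 = 0"
  proof (rule ccontr)
    assume "y mod 3 \<noteq> 0"
    then have "y div 3 = a div 3" "y div 3 = b div 3"
      using y ab unfolding l by (simp_all add: mem_blow_up_edge)
    then show False
      using dist ab' mod_3_cases_distinct[of y a b] assms(2,3) \<open>y mod 3 \<noteq> 0\<close>
        div_mod_eqI[of y 3 a] div_mod_eqI[of y 3 b] by auto
  qed
  show "(x div 3, a div 3) \<in> I" "(y div 3, a div 3) \<in> I"
    using I x y x0 y0 ab unfolding l by (simp_all add: mem_blow_up_edge)
qed

text \<open>Two distinct points lie on at most one common line, so both paths use copies of the same
  line, and \<open>a\<close> and \<open>b\<close> exhaust these copies.\<close>

lemma berge_path_through_line_unique: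
  assumes "four_cycle_free I"
    and path: "berge_path I x a b y" "a mod 3 \<noteq> 0" "b mod 3 \<noteq> 0"
    and path': "berge_path I x a' b' y" "a' mod 3 \<noteq> 0" "b' mod 3 \<noteq> 0"
  shows "a' \<in> {a, b}"
proof -
  note A = berge_path_through_line[OF path] and B = berge_path_through_line[OF path']
  have "x \<noteq> y" "a \<noteq> b"
    using path(1) by (auto simp: berge_path_def)
  have "x div 3 = y div 3 \<or> a div 3 = a' div 3"
    using four_cycle_freeD[OF assms(1) A(2,3) B(3,2)] .
  then have "a' div 3 = a div 3"
    using div_mod_eqI[of x 3 y] A(4,5) \<open>x \<noteq> y\<close> by auto
  moreover have "a' mod 3 = a mod 3 \<or> a' mod 3 = b mod 3"
    using mod_3_cases_distinct[of a' a b] path path' \<open>a \<noteq> b\<close> div_mod_eqI[of a 3 b] A(1) by auto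
  ultimately show ?thesis
    using A(1) div_mod_eqI[of a' 3] by auto
qed

text \<open>Here \<open>p\<close> is the point of the third edge. The first two edges share the
  point \<open>a\<close>, so their lines differ; the last two share the line of \<open>b\<close>, so
  their points differ.\<close>

lemma berge_path_through_point:
  assumes "berge_path I x a b y" "a mod 3 = 0"
  obtains p where "(a div 3, x div 3) \<in> I" "(a div 3, b div 3) \<in> I" "(p, b div 3) \<in> I"
    "p \<noteq> a div 3" "x div 3 \<noteq> b div 3" "y div 3 = (if y mod 3 = 0 then p else b div 3)"
proof -
  have "b mod 3 \<noteq> 0" "x mod 3 \<noteq> 0"
    using berge_path_not_both_points[OF assms] by auto
  then show ?thesis
    using assms(1)
  proof (elim berge_pathE)
    fix p1 l1 p2 l2 p3 l3
    assume "(p1, l1) \<in> I" "(p2, l2) \<in> I" "(p3, l3) \<in> I"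
      "p1 = p2 \<Longrightarrow> l1 \<noteq> l2" "p2 = p3 \<Longrightarrow> l2 \<noteq> l3"
      "x \<in> blow_up_edge (p1, l1)" "a \<in> blow_up_edge (p1, l1)" "a \<in> blow_up_edge (p2, l2)"
      "b \<in> blow_up_edge (p2, l2)" "b \<in> blow_up_edge (p3, l3)" "y \<in> blow_up_edge (p3, l3)"
    then show ?thesis
      using that[of p3] \<open>b mod 3 \<noteq> 0\<close> \<open>x mod 3 \<noteq> 0\<close> assms(2) by (auto simp: mem_blow_up_edge)
  qed
qed

text \<open>If y is a point, two such paths close up to a four- or six-cycle with
  lines x, b, b'; if y is a line, then y and b are copies of the same line.\<close>

lemma berge_path_through_point_unique:
  assumes four: "four_cycle_free I" and six: "six_cycle_free I"
    and path: "berge_path I x a b y" "a mod 3 = 0"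
    and path': "berge_path I x a' b' y" "a' mod 3 = 0"
  shows "a = a'"
proof -
  obtain p where A: "(a div 3, x div 3) \<in> I" "(a div 3, b div 3) \<in> I" "(p, b div 3) \<in> I"
    "p \<noteq> a div 3" "x div 3 \<noteq> b div 3" "y div 3 = (if y mod 3 = 0 then p else b div 3)"
    using berge_path_through_point[OF path] .
  obtain p' where B: "(a' div 3, x div 3) \<in> I" "(a' div 3, b' div 3) \<in> I" "(p', b' div 3) \<in> I"
    "p' \<noteq> a' div 3" "x div 3 \<noteq> b' div 3" "y div 3 = (if y mod 3 = 0 then p' else b' div 3)"
    using berge_path_through_point[OF path'] .
  \<comment> \<open>The lines of \<open>x\<close> and \<open>b\<close> are different and both pass
    through the points of \<open>a\<close> and \<open>a'\<close>.\<close>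
  have *: "a div 3 = a' div 3" if "b div 3 = b' div 3"
    using four_cycle_freeD[OF four A(1) B(1) B(2)] A(2,5) that by simp
  have "a div 3 = a' div 3"
  proof (cases "y mod 3 = 0")
    case True
    then have "p' = p"
      using A(6) B(6) by simp
    then have "(p, b' div 3) \<in> I" "p \<noteq> a' div 3"
      using B(3,4) by simp_all
    \<comment> \<open>The closed walk is a', x, a, b, p, b'. All coincidences are excluded except a
      = a', which is the goal, and b = b', which \<open>*\<close> settles.\<close>
    then show ?thesis
      using six_cycle_freeD[OF six B(1) A(1) A(2) A(3) _ B(2)] A(4,5) B(5) * by metis
  next
    case False
    then show ?thesis
      using A(6) B(6) * by simp
  qed
  then show ?thesis
    using div_mod_eqI[of a 3 a'] path(2) path'(2) by simp
qed

section \<open>Excluding the theta hypergraph by pigeonhole\<close>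

lemma blow_up_theta_free:
  assumes four: "four_cycle_free I" and six: "six_cycle_free I" and "t \<ge> 4"
  shows "\<not> contains_berge_theta 3 t V (blow_up_edge ` I)"
proof
  assume "contains_berge_theta 3 t V (blow_up_edge ` I)"
  then obtain x y and v :: "nat \<Rightarrow> nat \<Rightarrow> nat" and e :: "nat \<Rightarrow> nat \<Rightarrow> nat set" where xy: "x \<noteq> y"
    and v': "\<forall>i\<in>{1..t}. \<forall>j\<in>{1..3 - 1}. v i j \<in> V \<and> v i j \<noteq> x \<and> v i j \<noteq> y"
    and injv: "inj_on (\<lambda>(i, j). v i j) ({1..t} \<times> {1..3 - 1})"
    and e: "\<forall>i\<in>{1..t}. \<forall>j\<in>{1..3}. e i j \<in> blow_up_edge ` I"
    and inje: "inj_on (\<lambda>(i, j). e i j) ({1..t} \<times> {1..3})"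
    and inc': "\<forall>i\<in>{1..t}. {x, v i 1} \<subseteq> e i 1 \<and>
      (\<forall>j\<in>{2..3 - 1}. {v i (j - 1), v i j} \<subseteq> e i j) \<and> {v i (3 - 1), y} \<subseteq> e i 3"
    unfolding contains_berge_theta_def by (elim exE conjE) (rule that)
  have v: "v i 1 \<noteq> x" "v i 1 \<noteq> y" "v i 2 \<noteq> x" "v i 2 \<noteq> y" if "i \<in> {1..t}" for i
    using bspec[OF bspec[OF v' that], of 1] bspec[OF bspec[OF v' that], of 2] by auto
  have inc: "{x, v i 1} \<subseteq> e i 1" "{v i 1, v i 2} \<subseteq> e i 2" "{v i 2, y} \<subseteq> e i 3" if "i \<in> {1..t}" for i
    using bspec[OF inc' that] by simp_all
  have v_eq: "i = i' \<and> j = j'" if "v i j = v i' j'" "i \<in> {1..t}" "i' \<in> {1..t}" "j \<in> {1..2}" "j' \<in> {1..2}"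
    for i j i' j'
    using inj_onD[OF injv, of "(i, j)" "(i', j')"] that by auto
  have path: "berge_path I x (v i 1) (v i 2) y" if i: "i \<in> {1..t}" for i
  proof -
    have e_ne: "e i 1 \<noteq> e i 2" "e i 1 \<noteq> e i 3" "e i 2 \<noteq> e i 3"
      using inj_onD[OF inje, of "(i, 1)" "(i, 2)"] inj_onD[OF inje, of "(i, 1)" "(i, 3)"]
        inj_onD[OF inje, of "(i, 2)" "(i, 3)"] i by auto
    obtain f g h where fgh: "f \<in> I" "g \<in> I" "h \<in> I"
      "e i 1 = blow_up_edge f" "e i 2 = blow_up_edge g" "e i 3 = blow_up_edge h"
      using bspec[OF bspec[OF e i], of 1] bspec[OF bspec[OF e i], of 2] bspec[OF bspec[OF e i], of 3]
      by auto
    moreover have "distinct [f, g, h]"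
      using e_ne fgh by auto
    moreover have "distinct [x, v i 1, v i 2, y]"
      using v_eq[of i 1 i 2] v[OF i] xy i by auto
    ultimately show ?thesis
      unfolding berge_path_def using inc[OF i] by metis
  qed
  \<comment> \<open>\<open>kind\<close> records which inner vertices are points. It takes at most
    three values, and two paths of equal kind would share an inner vertex.\<close>
  define kind where "kind i = (v i 1 mod 3 = 0, v i 2 mod 3 = 0)" for i
  have "inj_on kind {1..t}"
  proof (rule inj_onI)
    fix i j assume ij: "i \<in> {1..t}" "j \<in> {1..t}" "kind i = kind j"
    then have kind: "v i 1 mod 3 = 0 \<longleftrightarrow> v j 1 mod 3 = 0" "v i 2 mod 3 = 0 \<longleftrightarrow> v j 2 mod 3 = 0"
      by (auto simp: kind_def)
    consider "v i 1 mod 3 = 0" | "v i 2 mod 3 = 0" | "v i 1 mod 3 \<noteq> 0" "v i 2 mod 3 \<noteq> 0"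
      by blast
    then show "i = j"
    proof cases
      case 1
      then have "v i 1 = v j 1"
        using berge_path_through_point_unique[OF four six path[OF ij(1)] 1 path[OF ij(2)]] kind 1 by simp
      then show ?thesis
        using v_eq[OF _ ij(1,2), of 1 1] by simp
    next
      case 2
      \<comment> \<open>Reversing both paths puts the second inner vertex first.\<close>
      then have "v i 2 = v j 2"
        using berge_path_through_point_unique[OF four six berge_path_sym[OF path[OF ij(1)]] 2
            berge_path_sym[OF path[OF ij(2)]]] kind 2 by simp
      then show ?thesis
        using v_eq[OF _ ij(1,2), of 2 2] by simp
    next
      case 3
      then have "v j 1 \<in> {v i 1, v i 2}"
        using berge_path_through_line_unique[OF four path[OF ij(1)] 3 path[OF ij(2)]] kind 3 by simp
      \<comment> \<open>The alternative \<open>v j 1 = v i 2\<close> is impossible, since the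
        positions 1 and 2 differ.\<close>
      then show ?thesis
        using v_eq[OF _ ij(2,1), of 1 1] v_eq[OF _ ij(2,1), of 1 2] by auto
    qed
  qed
  moreover have "kind ` {1..t} \<subseteq> {(True, False), (False, True), (False, False)}"
  proof (rule image_subsetI)
    fix i assume i: "i \<in> {1..t}"
    have "\<not> (v i 1 mod 3 = 0 \<and> v i 2 mod 3 = 0)"
      using berge_path_not_both_points(1)[OF path[OF i]] by metis
    then show "kind i \<in> {(True, False), (False, True), (False, False)}"
      unfolding kind_def by (cases "v i 1 mod 3 = 0"; cases "v i 2 mod 3 = 0") simp_all
  qed
  ultimately have "card {1..t} \<le> card {(True, False), (False, True), (False, False)}"
    by (rule card_inj_on_le) simp
  then show False
    using \<open>t \<ge> 4\<close> by simp
qed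

section \<open>From the construction to the bound for all large \<open>n\<close>\<close>

lemma turan_number_ge:
  assumes "uniform_hypergraph r V E" "card V = n" "\<not> contains V E"
  shows "card E \<le> turan_number r n contains"
  unfolding turan_number_def by (rule Max_ge[OF turan_number_finite]) (use assms in blast)

text \<open>All labels used lie below \<open>3 * q ^ 3\<close>; the vertices of
  \<open>{..<n}\<close> beyond them are isolated.\<close>

lemma turan_number_berge_theta_ge:
  assumes "k > 0" "t \<ge> 4" "3 * (2 ^ k) ^ 3 \<le> n"
  shows "(2 ^ k) ^ 4 \<le> turan_number 3 n (contains_berge_theta 3 t)"
proof -
  define q :: nat where "q = 2 ^ k"
  obtain I :: "(nat \<times> nat) set" where I: "I \<subseteq> {..<q ^ 3} \<times> {..<q ^ 3}" "card I = q ^ 4"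
    "four_cycle_free I" "six_cycle_free I"
    using ex_bipartite_girth_eight[OF assms(1)] unfolding q_def by metis
  have "blow_up_edge e \<subseteq> {..<n}" if "e \<in> I" for e
  proof -
    obtain p l where "e = (p, l)" "p < q ^ 3" "l < q ^ 3"
      using \<open>e \<in> I\<close> I(1) by (cases e) auto
    then show ?thesis
      using assms(3) unfolding q_def[symmetric] by (auto simp: blow_up_edge_def)
  qed
  then have "uniform_hypergraph 3 {..<n} (blow_up_edge ` I)"
    by (auto simp: uniform_hypergraph_def card_blow_up_edge)
  then have "card (blow_up_edge ` I) \<le> turan_number 3 n (contains_berge_theta 3 t)"
    using blow_up_theta_free[OF I(3,4) assms(2)] by (intro turan_number_ge[where V = "{..<n}"]) simp_all
  then show ?thesis
    using I(2) card_image[OF inj_on_subset[OF inj_blow_up_edge subset_UNIV]] by (simp add: q_def)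
qed

text \<open>Cubes of powers of two are powers of 8, so rounding \<open>n div 3\<close> down to one
  loses a factor below 8, and 24 = 3 * 8. The bound \<open>n \<ge> 24\<close> makes
  \<open>n div 3\<close> at least 8, which forces \<open>k > 0\<close>.\<close>

lemma ex_power_of_two_cube:
  fixes n :: nat
  assumes "n \<ge> 24"
  obtains k :: nat where "k > 0" "3 * (2 ^ k) ^ 3 \<le> n" "n < 24 * (2 ^ k) ^ 3"
proof -
  obtain k where k: "8 ^ k \<le> n div 3" "n div 3 < 8 ^ (k + 1)"
    using ex_power_ivl1[of 8 "n div 3"] assms by fastforce
  show ?thesis
  proof
    show "k > 0"
      using k assms by (cases k) auto
    have "(2 ^ k) ^ 3 = (8 :: nat) ^ k"
      by (simp flip: power_mult add: mult.commute[of k]) (simp add: power_mult)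
    then show "3 * (2 ^ k) ^ 3 \<le> n" "n < 24 * (2 ^ k) ^ 3"
      using k by auto
  qed
qed

theorem theorem1:
  shows "\<exists>c>0. \<exists>n0::nat. \<forall>n\<ge>n0.
    real (turan_number 3 n (contains_berge_theta 3 217)) \<ge> c * real n powr (4/3)"
\<comment> \<open>With q = 2^k and n < 24 q^3, the edge count q^4 = (q^3)^(4/3) is at least (n /
  24)^(4/3), which dictates the constant.\<close>
proof (intro exI[of _ "(1 / 24) powr (4 / 3)"] conjI exI[of _ 24] allI impI)
  show "(0 :: real) < (1 / 24) powr (4 / 3)"
    by simp
  fix n :: nat
  assume "n \<ge> 24"
  then obtain k where k: "k > 0" "3 * (2 ^ k) ^ 3 \<le> n" "n < 24 * (2 ^ k) ^ 3"
    using ex_power_of_two_cube by blast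
  have "real n < real (24 * (2 ^ k) ^ 3)"
    using k(3) by (simp only: of_nat_less_iff)
  then have "real n / 24 \<le> (2 ^ k) ^ 3"
    by simp
  then have "(real n / 24) powr (4 / 3) \<le> ((2 ^ k) ^ 3) powr (4 / 3)"
    by (intro powr_mono2) auto
  also have "\<dots> = (2 ^ k) ^ 4"
    by (simp add: powr_powr mult.commute flip: powr_realpow)
  also have "\<dots> \<le> real (turan_number 3 n (contains_berge_theta 3 217))"
    using turan_number_berge_theta_ge[OF k(1) _ k(2), of 217] of_nat_mono by fastforce
  finally show "(1 / 24) powr (4 / 3) * real n powr (4 / 3)
      \<le> real (turan_number 3 n (contains_berge_theta 3 217))"
    by (simp add: powr_mult powr_divide divide_simps)
qed

end
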